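(* Let $Q\subset\mathbb{R}^n$ be a cube with sides parallel to the coordinate axes, and let $0<\alpha<1$ and $1\leq p<q\leq\infty$ satisfy $\frac1p-\frac1q=\alpha$. Then the fractional averaging operator $A_{Q,\alpha}:L^p_{\mathcal{K}}(\mathbb{R}^n,|\cdot|)\to L^q_{\mathcal{K}}(\mathbb{R}^n,|\cdot|)$ is bounded; that is, there is a constant $C$ such that $\lVert A_{Q,\alpha}F\rVert_{L^q_{\mathcal{K}}(\mathbb{R}^n,|\cdot|)}\leq C\lVert F\rVert_{L^p_{\mathcal{K}}(\mathbb{R}^n,|\cdot|)}$ for all $F\in L^p_{\mathcal{K}}(\mathbb{R}^n,|\cdot|)$.
   Context: $\mathcal{K}_{bcs}(\mathbb{R}^d)$ is the collection of all nonempty, closed, bounded, convex, symmetric ($-E=E$) subsets of $\mathbb{R}^d$. $\mathbb{R}^n$ carries Lebesgue measure, $|Q|=m_n(Q)$ is the Lebesgue measure of $Q$. A function $F:\mathbb{R}^n\to\mathcal{K}_{bcs}(\mathbb{R}^d)$ is measurable if $\{x:F(x)\cap U\neq\emptyset\}$ is measurable for every open $U\subset\mathbb{R}^d$. It is locally integrably bounded if it is measurable and there is a non-negative $k\in L^1_{loc}(\mathbb{R}^n)$ such that $F(x)$ is contained in the ball $B(0,k(x))$ for a.e. $x$. For $E\subset\mathbb{R}^d$, $|E|=\sup_{v\in E}|v|$ (Euclidean norm). For $0<p<\infty$, $L^p_{\mathcal{K}}(\mathbb{R}^n,|\cdot|)$ is the set of measurable $F:\mathbb{R}^n\to\mathcal{K}_{bcs}(\mathbb{R}^d)$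 with $\lVert F\rVert_{L^p_{\mathcal{K}}(\mathbb{R}^n,|\cdot|)}=\left(\int_{\mathbb{R}^n}|F(x)|^p\,dx\right)^{1/p}<\infty$; for $p=\infty$ the norm is $\operatorname{ess\,sup}_x|F(x)|$. The Aumann integral of $F$ over $Q$ is $\int_Q F(y)\,dy=\left\{\int_Q f(y)\,dy: f\in L^1(Q,\mathbb{R}^d)\text{ measurable},\ f(y)\in F(y)\text{ for a.e. }y\in Q\right\}$. The fractional averaging operator is defined for locally integrably bounded $F$ by $A_{Q,\alpha}F(x)=\frac{1}{|Q|^{1-\alpha}}\int_Q F(y)\,dy\cdot\chi_Q(x)$, where $\lambda E=\{\lambda v:v\in E\}$ (so the value is $\{0\}$ for $x\notin Q$). *)

theory Defs
  imports "HOL-Probability.Essential_Supremum"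
begin

definition K_bcs :: "('a::euclidean_space) set set" where
  "K_bcs = {E. E \<noteq> {} \<and> closed E \<and> bounded E \<and> convex E \<and> uminus ` E = E}"

definition setvalued_measurable :: "('a::euclidean_space \<Rightarrow> 'b::euclidean_space set) \<Rightarrow> bool" where
  "setvalued_measurable F \<longleftrightarrow> (\<forall>U. open U \<longrightarrow> {x. F x \<inter> U \<noteq> {}} \<in> sets lebesgue)"

definition locally_integrably_bounded :: "('a::euclidean_space \<Rightarrow> 'b::euclidean_space set) \<Rightarrow> bool" where
  "locally_integrably_bounded F \<longleftrightarrow>
     setvalued_measurable F \<and>
     (\<exists>k :: 'a \<Rightarrow> real.
        k \<in> borel_measurable lebesgue \<and> (\<forall>x. 0 \<le> k x) \<and>
        (\<forall>S. compact S \<longrightarrow> set_integrable lebesgue S k) \<and>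
        (AE x in lebesgue. F x \<subseteq> cball 0 (k x)))"

text \<open>The supremum is the real one, so it is meaningful only for nonempty bounded sets; all
  functions in \<open>LK p\<close> below take such values.\<close>

definition set_norm :: "'a::real_normed_vector set \<Rightarrow> real" where
  "set_norm E = (SUP v\<in>E. norm v)"

text \<open>\<open>powr\<close> is not available on extended reals, hence the explicit treatment of an infinite
  integral.\<close>

definition LK_norm :: "ereal \<Rightarrow> ('a::euclidean_space \<Rightarrow> 'b::euclidean_space set) \<Rightarrow> ennreal" where
  "LK_norm p F =
     (if p = \<infinity> then esssup lebesgue (\<lambda>x. ennreal (set_norm (F x)))
      else let I = \<integral>\<^sup>+ x. ennreal (set_norm (F x) powr real_of_ereal p) \<partial>lebesgue
           in if I = \<infinity> then \<infinity> else ennreal (enn2real I powr (1 / real_of_ereal p)))"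

definition LK :: "ereal \<Rightarrow> ('a::euclidean_space \<Rightarrow> 'b::euclidean_space set) set" where
  "LK p = {F. (\<forall>x. F x \<in> K_bcs) \<and> setvalued_measurable F \<and> LK_norm p F < \<infinity>}"

definition aumann_integral ::
    "'a::euclidean_space set \<Rightarrow> ('a \<Rightarrow> 'b::euclidean_space set) \<Rightarrow> 'b set" where
  "aumann_integral Q F =
     {(LINT y:Q|lebesgue. f y) | f.
        set_integrable lebesgue Q f \<and> (AE y in lebesgue. y \<in> Q \<longrightarrow> f y \<in> F y)}"

definition frac_avg ::
    "'a::euclidean_space set \<Rightarrow> real \<Rightarrow> ('a \<Rightarrow> 'b::euclidean_space set) \<Rightarrow> 'a \<Rightarrow> 'b set" where
  "frac_avg Q \<alpha> F x =
     (\<lambda>v. (1 / measure lebesgue Q powr (1 - \<alpha>) * indicator Q x) *\<^sub>R v) ` aumann_integral Q F"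

text \<open>A nondegenerate cube is a product of intervals of equal length; every interval may be open,
  closed or half-open.\<close>

definition axis_parallel_cube :: "(real ^ 'n) set \<Rightarrow> bool" where
  "axis_parallel_cube Q \<longleftrightarrow>
     (\<exists>a l I. 0 < l \<and>
        (\<forall>i. {a $ i <..< a $ i + l} \<subseteq> I i \<and> I i \<subseteq> {a $ i .. a $ i + l}) \<and>
        Q = {x. \<forall>i. x $ i \<in> I i})"

end

theory Submission
  imports Defs
begin

text \<open>On \<open>Q\<close> the average is one fixed set \<open>E\<close>, and off \<open>Q\<close> it is \<open>{0}\<close>; so its \<open>L\<^sup>q\<close> norm is
  controlled by the norm of \<open>E\<close>, hence by \<open>\<integral>\<^sub>Q |F|\<close>, hence by the \<open>L\<^sup>p\<close> norm of \<open>F\<close>. The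
  delicate point is that the Aumann integral is closed: among the selections whose integral is
  nearly a given limit point, those nearly minimising a weighted \<open>L\<^sup>2\<close> norm converge.\<close>

section \<open>Closedness of the set of integrals of selections\<close>

text \<open>Along a subsequence whose consecutive L1 distances are at most 2^-n, the sum of the
  pointwise increments has finite integral. The increments are therefore absolutely summable almost
  everywhere, and they telescope.\<close>

lemma L1_Cauchy_imp_AE_convergent_subseq:
  fixes f :: "nat \<Rightarrow> 'a \<Rightarrow> 'b::{banach, second_countable_topology}"
  assumes f: "\<And>n. integrable M (f n)"
    and Cauchy: "\<And>e. 0 < e \<Longrightarrow> \<exists>N. \<forall>m\<ge>N. \<forall>n\<ge>N. (\<integral>x. norm (f m x - f n x) \<partial>M) < e"
  obtains r :: "nat \<Rightarrow> nat" where "strict_mono r" "AE x in M. convergent (\<lambda>n. f (r n) x)"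
proof -
  have "\<exists>N. \<forall>m\<ge>N. \<forall>n\<ge>N. (\<integral>x. norm (f m x - f n x) \<partial>M) < (1/2)^k" for k :: nat
    by (rule Cauchy) simp
  then obtain N where N: "\<And>k m n. N k \<le> m \<Longrightarrow> N k \<le> n \<Longrightarrow> (\<integral>x. norm (f m x - f n x) \<partial>M) < (1/2)^k"
    by metis
  \<comment> \<open>Both \<open>r n\<close> and \<open>r (Suc n)\<close> must lie beyond
    \<open>N n\<close>, so that their L1 distance is below 2^-n.\<close>
  have "\<exists>r::nat \<Rightarrow> nat. \<forall>n. N n \<le> r n \<and> r n < r (Suc n)"
  proof (rule dependent_nat_choice)
    show "\<exists>x. N 0 \<le> x" by blast
    show "\<exists>y. N (Suc n) \<le> y \<and> x < y" for x n :: nat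
      by (rule exI[of _ "max (N (Suc n)) (Suc x)"]) auto
  qed
  then obtain r where r: "\<And>n. N n \<le> r n" "\<And>n. r n < r (Suc n)" by blast
  have mono: "strict_mono r" using r(2) by (rule strict_mono_Suc_iff[THEN iffD2, rule_format])
  define d where "d n x = norm (f (r (Suc n)) x - f (r n) x)" for n x
  have d_nonneg: "0 \<le> d n x" for n x by (simp add: d_def)
  have d_int: "integrable M (d n)" for n
    unfolding d_def by (intro integrable_norm Bochner_Integration.integrable_diff f)
  have d_le: "(\<integral>x. d n x \<partial>M) \<le> (1/2)^n" for n
    unfolding d_def using N[of n "r (Suc n)" "r n"] r(1)[of n] r(2)[of n] by force
  have "(\<integral>\<^sup>+x. (\<Sum>n. ennreal (d n x)) \<partial>M) = (\<Sum>n. \<integral>\<^sup>+x. ennreal (d n x) \<partial>M)"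
    using d_int by (intro nn_integral_suminf) auto
  also have "\<dots> \<le> (\<Sum>n. ennreal ((1/2)^n))"
    using d_int d_le by (intro suminf_le) (auto simp: nn_integral_eq_integral d_nonneg intro!: ennreal_leI)
  also have "\<dots> = ennreal (\<Sum>n. (1/2)^n)"
    by (intro suminf_ennreal2) (auto intro!: summable_geometric)
  finally have "(\<integral>\<^sup>+x. (\<Sum>n. ennreal (d n x)) \<partial>M) \<noteq> \<infinity>"
    by (auto simp: top_unique)
  then have "AE x in M. (\<Sum>n. ennreal (d n x)) \<noteq> \<infinity>"
    using d_int by (intro nn_integral_PInf_AE) auto
  then have "AE x in M. convergent (\<lambda>n. f (r n) x)"
  proof eventually_elim
    case (elim x)
    then have "summable (\<lambda>n. d n x)"
      by (intro summable_suminf_not_top) (auto simp: d_def)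
    then have "summable (\<lambda>n. f (r (Suc n)) x - f (r n) x)"
      unfolding d_def by (rule summable_norm_cancel)
    then have "(\<lambda>n. \<Sum>i<n. f (r (Suc i)) x - f (r i) x) \<longlonglongrightarrow> (\<Sum>n. f (r (Suc n)) x - f (r n) x)"
      by (rule summable_LIMSEQ)
    then have "(\<lambda>n. f (r n) x - f (r 0) x) \<longlonglongrightarrow> (\<Sum>n. f (r (Suc n)) x - f (r n) x)"
      by (simp only: sum_lessThan_telescope[of "\<lambda>n. f (r n) x"])
    from tendsto_add[OF this tendsto_const[of "f (r 0) x"]] show ?case
      by (auto simp: convergent_def)
  qed
  with mono show thesis by (rule that)
qed

text \<open>The minimising sequence of the strictly convex functional \<open>J\<close> over the selections whose
  integral is close to \<open>v\<close> is Cauchy in \<open>L\<^sup>1\<close> by the parallelogram identity, so no weak compactness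
  is needed. The weight \<open>w\<close> makes \<open>J\<close> finite although the selections are only integrable.\<close>

lemma closed_integrals_of_selections:
  fixes F :: "'a \<Rightarrow> 'b::euclidean_space set"
  assumes "finite_measure M" and g: "integrable M g"
    and bound: "\<And>x v. x \<in> space M \<Longrightarrow> v \<in> F x \<Longrightarrow> norm v \<le> g x"
    and closed: "\<And>x. x \<in> space M \<Longrightarrow> closed (F x)"
    and convex: "\<And>x. x \<in> space M \<Longrightarrow> convex (F x)"
  shows "closed {\<integral>x. f x \<partial>M | f. integrable M f \<and> (AE x in M. f x \<in> F x)}" (is "closed ?A")
proof -
  interpret finite_measure M by fact
  define w where "w x = 1 / (1 + \<bar>g x\<bar>)" for x
  have w_pos: "0 < w x" for x by (simp add: w_def add_pos_nonneg)
  have w_meas[measurable]: "w \<in> borel_measurable M"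
    using borel_measurable_integrable[OF g] unfolding w_def by measurable
  define J where "J f = (\<integral>x. w x * (norm (f x))\<^sup>2 \<partial>M)" for f :: "'a \<Rightarrow> 'b"
  define S where "S = {f. integrable M f \<and> (AE x in M. f x \<in> F x)}"
  have S_bound: "AE x in M. norm (f x) \<le> g x" if "f \<in> S" for f
    using that bound by (auto simp: S_def)
  \<comment> \<open>This is what the weight is chosen for: \<open>g\<close> dominates the integrand
    of \<open>J\<close>, so \<open>J\<close> is at most \<integral> g on all selections.\<close>
  have w_sq_le: "w x * (norm u)\<^sup>2 \<le> g x" if "norm u \<le> g x" for x and u :: 'b
  proof -
    have "(norm u)\<^sup>2 \<le> g x * (1 + \<bar>g x\<bar>)"
      using mult_mono[of "norm u" "g x" "norm u" "1 + \<bar>g x\<bar>"] that norm_ge_zero[of u]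
      unfolding power2_eq_square by linarith
    then show ?thesis by (simp add: w_def divide_simps add_pos_nonneg)
  qed
  have J_integrable: "integrable M (\<lambda>x. w x * (norm (f x))\<^sup>2)" if "f \<in> S" for f
  proof (rule Bochner_Integration.integrable_bound[OF g])
    show "(\<lambda>x. w x * (norm (f x))\<^sup>2) \<in> borel_measurable M"
      using that by (auto simp: S_def)
    show "AE x in M. norm (w x * (norm (f x))\<^sup>2) \<le> norm (g x)"
      using S_bound[OF that]
    proof eventually_elim
      case (elim x)
      from w_sq_le[OF elim] w_pos[of x] show ?case by simp
    qed
  qed
  have J_le: "J f \<le> (\<integral>x. g x \<partial>M)" if "f \<in> S" for f
    unfolding J_def using S_bound[OF that] w_sq_le
    by (intro integral_mono_AE J_integrable that g) auto
  have J_ge: "0 \<le> J f" for f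
    unfolding J_def using w_pos by (intro integral_nonneg_AE) (auto simp: less_imp_le)
  \<comment> \<open>The identity is stated with the midpoint because midpoints of selections are
    again selections, by convexity of the values.\<close>
  have parallelogram: "norm (x - y) ^ 2 = 2 * norm x ^ 2 + 2 * norm y ^ 2 - 4 * norm ((1/2) *\<^sub>R x + (1/2) *\<^sub>R y) ^ 2"
    for x y :: 'b
    by (simp add: power2_norm_eq_inner algebra_simps inner_commute)
  have mid: "(\<lambda>x. (1/2) *\<^sub>R f x + (1/2) *\<^sub>R h x) \<in> S" if "f \<in> S" "h \<in> S" for f h
  proof -
    have "AE x in M. f x \<in> F x \<and> h x \<in> F x" using that by (auto simp: S_def)
    then have "AE x in M. (1/2) *\<^sub>R f x + (1/2) *\<^sub>R h x \<in> F x"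
      using AE_space by eventually_elim (rule convexD[OF convex], auto)
    with that show ?thesis by (auto simp: S_def)
  qed
  have J_diff: "integrable M (\<lambda>x. w x * (norm (f x - h x))\<^sup>2)"
      "(\<integral>x. w x * (norm (f x - h x))\<^sup>2 \<partial>M)
        = 2 * J f + 2 * J h - 4 * J (\<lambda>x. (1/2) *\<^sub>R f x + (1/2) *\<^sub>R h x)"
    if "f \<in> S" "h \<in> S" for f h
  proof -
    have *: "(\<lambda>x. w x * (norm (f x - h x))\<^sup>2) = (\<lambda>x. 2 * (w x * (norm (f x))\<^sup>2) + 2 * (w x * (norm (h x))\<^sup>2)
        - 4 * (w x * (norm ((1/2) *\<^sub>R f x + (1/2) *\<^sub>R h x))\<^sup>2))"
      by (subst parallelogram) (simp add: algebra_simps)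
    note i = J_integrable[OF that(1)] J_integrable[OF that(2)] J_integrable[OF mid[OF that]]
    show "integrable M (\<lambda>x. w x * (norm (f x - h x))\<^sup>2)"
      unfolding * using i by auto
    show "(\<integral>x. w x * (norm (f x - h x))\<^sup>2 \<partial>M)
        = 2 * J f + 2 * J h - 4 * J (\<lambda>x. (1/2) *\<^sub>R f x + (1/2) *\<^sub>R h x)"
      unfolding * J_def using i by simp
  qed
  define G where "G = (\<integral>x. 1 + \<bar>g x\<bar> \<partial>M)"
  have G_int: "integrable M (\<lambda>x. 1 + \<bar>g x\<bar>)" using g by auto
  have G_ge: "0 \<le> G" unfolding G_def by (intro integral_nonneg_AE) auto
  have L1_le: "(\<integral>x. norm (f x - h x) \<partial>M)
      \<le> \<epsilon> * G + (2 * J f + 2 * J h - 4 * J (\<lambda>x. (1/2) *\<^sub>R f x + (1/2) *\<^sub>R h x)) / \<epsilon>"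
    if "f \<in> S" "h \<in> S" "0 < \<epsilon>" for f h \<epsilon>
  proof -
    \<comment> \<open>This is t \<le> a + t^2/a with t = \<open>norm u\<close> and a = \<epsilon> (1
      + |g x|): the first term suffices if t \<le> a, the second otherwise. After integration it
      turns weighted L2 smallness into L1 smallness, with \<epsilon> still free.\<close>
    have pt: "norm u \<le> \<epsilon> * (1 + \<bar>g x\<bar>) + (w x * (norm u)\<^sup>2) / \<epsilon>" for x and u :: 'b
    proof -
      define a where "a = \<epsilon> * (1 + \<bar>g x\<bar>)"
      have a: "0 < a" using that by (simp add: a_def add_pos_nonneg)
      have eq: "(w x * (norm u)\<^sup>2) / \<epsilon> = (norm u)\<^sup>2 / a" by (simp add: w_def a_def)
      have "norm u \<le> a + (norm u)\<^sup>2 / a"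
      proof (cases "norm u \<le> a")
        case True
        with a show ?thesis by (simp add: add_increasing2)
      next
        case False
        then have "norm u * a \<le> norm u * norm u" by (intro mult_left_mono) auto
        with a have "norm u \<le> (norm u)\<^sup>2 / a" by (simp add: pos_le_divide_eq power2_eq_square)
        with a show ?thesis by simp
      qed
      then show ?thesis by (simp add: eq a_def)
    qed
    have "(\<integral>x. norm (f x - h x) \<partial>M)
        \<le> (\<integral>x. \<epsilon> * (1 + \<bar>g x\<bar>) + (w x * (norm (f x - h x))\<^sup>2) / \<epsilon> \<partial>M)"
      using that pt J_diff(1)[OF that(1,2)] G_int
      by (intro integral_mono) (auto simp: S_def simp del: distrib_left_numeral)
    also have "\<dots> = \<epsilon> * G + (\<integral>x. w x * (norm (f x - h x))\<^sup>2 \<partial>M) / \<epsilon>"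
      using J_diff(1)[OF that(1,2)] G_int unfolding G_def
      by (subst Bochner_Integration.integral_add) (auto simp del: Bochner_Integration.integral_add)
    finally show ?thesis using J_diff(2)[OF that(1,2)] by simp
  qed
  show ?thesis
    unfolding closure_subset_eq[symmetric]
  proof
    fix v assume v: "v \<in> closure ?A"
    \<comment> \<open>These sets are nonempty because \<open>v\<close> is in the closure, decrease
      in \<open>k\<close>, and are stable under midpoints because balls are convex.\<close>
    define T where "T k = {f \<in> S. dist (\<integral>x. f x \<partial>M) v \<le> 1 / real (Suc k)}" for k
    have T_S: "f \<in> T k \<Longrightarrow> f \<in> S" for f k by (auto simp: T_def)
    have T_ne: "T k \<noteq> {}" for k
    proof -
      have "0 < 1 / real (Suc k)" by simp
      with v obtain a where "a \<in> ?A" "dist a v < 1 / real (Suc k)"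
        unfolding closure_approachable by blast
      then show ?thesis unfolding T_def S_def by (auto intro: less_imp_le)
    qed
    have T_anti: "T l \<subseteq> T k" if "k \<le> l" for k l
    proof -
      have "1 / real (Suc l) \<le> 1 / real (Suc k)" using that by (simp add: divide_simps)
      then show ?thesis unfolding T_def by auto
    qed
    have T_mid: "(\<lambda>x. (1/2) *\<^sub>R f x + (1/2) *\<^sub>R h x) \<in> T k" if "f \<in> T k" "h \<in> T k" for f h k
    proof -
      have "(1/2) *\<^sub>R (\<integral>x. f x \<partial>M) + (1/2) *\<^sub>R (\<integral>x. h x \<partial>M) \<in> cball v (1 / real (Suc k))"
        using that by (intro convexD[OF convex_cball]) (auto simp: T_def dist_commute)
      with that mid show ?thesis by (auto simp: T_def S_def dist_commute)
    qed
    \<comment> \<open>As \<open>T k\<close> shrinks, the infima increase; being bounded by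
      \<integral> g, they converge to some \<open>L\<close>.\<close>
    define m where "m k = Inf (J ` T k)" for k
    have bdd: "bdd_below (J ` T k)" for k using J_ge by (intro bdd_belowI[of _ 0]) auto
    have m_le: "m k \<le> J f" if "f \<in> T k" for f k
      unfolding m_def using that bdd by (intro cINF_lower) auto
    have m_mono: "incseq m"
      unfolding incseq_def m_def using T_anti T_ne bdd by (intro allI impI cINF_superset_mono) auto
    have "\<exists>f. f \<in> T k \<and> J f < m k + 1 / real (Suc k)" for k
    proof -
      have "Inf (J ` T k) < m k + 1 / real (Suc k)" by (simp add: m_def)
      then show ?thesis using T_ne bdd by (subst (asm) cInf_less_iff) auto
    qed
    then obtain f where fT: "\<And>k. f k \<in> T k" and fJ: "\<And>k. J (f k) < m k + 1 / real (Suc k)"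
      by metis
    have fS: "f k \<in> S" for k using fT T_S by blast
    have f_int: "integrable M (f k)" for k using fS by (auto simp: S_def)
    have "m k \<le> (\<integral>x. g x \<partial>M)" for k
      using m_le[OF fT] J_le[OF fS] by (rule order_trans)
    then obtain L where L: "m \<longlonglongrightarrow> L" "\<And>k. m k \<le> L"
      using incseq_convergent[OF m_mono] by metis
    \<comment> \<open>The midpoint lies in \<open>T n\<close>, so its \<open>J\<close> is at least
      \<open>m n\<close>, while \<open>f k\<close> and \<open>f l\<close> have \<open>J\<close> at
      most \<open>L\<close> + 1/(n+1).\<close>
    have gap: "2 * J (f k) + 2 * J (f l) - 4 * J (\<lambda>x. (1/2) *\<^sub>R f k x + (1/2) *\<^sub>R f l x)
        \<le> 2 * (L - m n) + 4 / real (Suc n) + 2 * (L - m n)" if "n \<le> k" "n \<le> l" for k l n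
    proof -
      have "m n \<le> J (\<lambda>x. (1/2) *\<^sub>R f k x + (1/2) *\<^sub>R f l x)"
        using that fT T_anti by (intro m_le T_mid) blast+
      moreover have "J (f j) \<le> L + 1 / real (Suc n)" if "n \<le> j" for j
      proof -
        have "1 / real (Suc j) \<le> 1 / real (Suc n)" using that by (simp add: divide_simps)
        with fJ[of j] L(2)[of j] show ?thesis by linarith
      qed
      from this[OF that(1)] this[OF that(2)]
      have "J (f k) \<le> L + 1 / real (Suc n)" "J (f l) \<le> L + 1 / real (Suc n)" .
      ultimately show ?thesis by (simp add: algebra_simps)
    qed
    have gap0: "(\<lambda>n. 2 * (L - m n) + 4 / real (Suc n) + 2 * (L - m n)) \<longlonglongrightarrow> 0"
    proof -
      have "(\<lambda>n. 2 * (L - m n) + 4 * (1 / real (Suc n)) + 2 * (L - m n))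
          \<longlonglongrightarrow> 2 * (L - L) + 4 * 0 + 2 * (L - L)"
        using LIMSEQ_inverse_real_of_nat
        by (intro tendsto_intros L(1)) (simp add: inverse_eq_divide)
      then show ?thesis by simp
    qed
    have "\<exists>N. \<forall>k\<ge>N. \<forall>l\<ge>N. (\<integral>x. norm (f k x - f l x) \<partial>M) < e" if e: "0 < e" for e
    proof -
      \<comment> \<open>This bounds the first term of \<open>L1_le\<close> by e/2, and the 1 covers
        \<open>G\<close> = 0. With \<epsilon> fixed, a late \<open>N\<close> makes the gap divided
        by \<epsilon> less than e/2.\<close>
      define \<epsilon> where "\<epsilon> = e / (2 * (G + 1))"
      have eps: "0 < \<epsilon>" using e G_ge by (simp add: \<epsilon>_def)
      have epsG: "\<epsilon> * G \<le> e / 2"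
        using e G_ge by (simp add: \<epsilon>_def divide_simps)
      have "\<forall>\<^sub>F n in sequentially. 2 * (L - m n) + 4 / real (Suc n) + 2 * (L - m n) < \<epsilon> * (e / 2)"
        using eps e by (intro order_tendstoD(2)[OF gap0]) auto
      then obtain N where N: "2 * (L - m N) + 4 / real (Suc N) + 2 * (L - m N) < \<epsilon> * (e / 2)"
        by (auto simp: eventually_sequentially)
      have "(\<integral>x. norm (f k x - f l x) \<partial>M) < e" if "N \<le> k" "N \<le> l" for k l
      proof -
        have "(2 * J (f k) + 2 * J (f l) - 4 * J (\<lambda>x. (1/2) *\<^sub>R f k x + (1/2) *\<^sub>R f l x)) / \<epsilon> < e / 2"
          using gap[OF that] N eps by (simp add: pos_divide_less_eq mult.commute)
        with L1_le[OF fS fS eps, of k l] epsG show ?thesis by linarith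
      qed
      then show ?thesis by blast
    qed
    from L1_Cauchy_imp_AE_convergent_subseq[OF f_int this]
    obtain r where r: "strict_mono r" and conv: "AE x in M. convergent (\<lambda>n. f (r n) x)" by blast
    \<comment> \<open>Where the subsequence diverges the value is arbitrary, but that happens only
      on a null set.\<close>
    define h where "h x = lim (\<lambda>n. f (r n) x)" for x
    have h_meas: "h \<in> borel_measurable M"
      unfolding h_def using f_int by (intro borel_measurable_lim_metric) auto
    have h_lim: "AE x in M. (\<lambda>n. f (r n) x) \<longlonglongrightarrow> h x"
      using conv unfolding h_def by eventually_elim (simp add: convergent_LIMSEQ_iff)
    have f_le: "AE x in M. norm (f (r n) x) \<le> g x" for n by (rule S_bound[OF fS])
    have h_int: "integrable M h"
      by (rule integrable_dominated_convergence[OF h_meas _ g h_lim f_le]) (use f_int in auto)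
    have lim_int: "(\<lambda>n. \<integral>x. f (r n) x \<partial>M) \<longlonglongrightarrow> (\<integral>x. h x \<partial>M)"
      by (rule integral_dominated_convergence[OF h_meas _ g h_lim f_le]) (use f_int in auto)
    \<comment> \<open>Countably many exceptional null sets are merged, so that closedness of
      \<open>F x\<close> applies to the whole sequence at once.\<close>
    have "AE x in M. \<forall>n. f (r n) x \<in> F x"
      using fS unfolding AE_all_countable by (auto simp: S_def)
    with h_lim AE_space have h_F: "AE x in M. h x \<in> F x"
      by eventually_elim (rule closed_sequentially[OF closed], auto)
    have "(\<lambda>n. \<integral>x. f n x \<partial>M) \<longlonglongrightarrow> v"
    proof (rule metric_LIMSEQ_I)
      fix e :: real assume "0 < e"
      then obtain N where "1 / real (Suc N) < e" by (rule nat_approx_posE)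
      moreover have "dist (\<integral>x. f n x \<partial>M) v \<le> 1 / real (Suc N)" if "N \<le> n" for n
        using T_anti[OF that] fT[of n] by (auto simp: T_def)
      ultimately show "\<exists>N. \<forall>n\<ge>N. dist (\<integral>x. f n x \<partial>M) v < e" by force
    qed
    from LIMSEQ_subseq_LIMSEQ[OF this r] lim_int have "v = (\<integral>x. h x \<partial>M)"
      by (auto simp: o_def intro: LIMSEQ_unique)
    with h_int h_F show "v \<in> ?A" by blast
  qed
qed

section \<open>The norm of a set and the class \<open>K_bcs\<close>\<close>

lemma norm_le_set_norm: "bounded E \<Longrightarrow> v \<in> E \<Longrightarrow> norm v \<le> set_norm E"
  unfolding set_norm_def by (rule cSUP_upper) (auto simp: bdd_above_norm)

lemma set_norm_le: "E \<noteq> {} \<Longrightarrow> (\<And>v. v \<in> E \<Longrightarrow> norm v \<le> c) \<Longrightarrow> set_norm E \<le> c"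
  unfolding set_norm_def by (rule cSUP_least)

lemma set_norm_nonneg: "E \<noteq> {} \<Longrightarrow> bounded E \<Longrightarrow> 0 \<le> set_norm E"
  using norm_le_set_norm norm_ge_zero by (metis ex_in_conv order_trans)

lemma set_norm_zero [simp]: "set_norm {0} = 0"
  by (simp add: set_norm_def)

lemma zero_mem_K_bcs:
  assumes "E \<in> K_bcs"
  shows "0 \<in> E"
proof -
  obtain v where v: "v \<in> E" using assms by (auto simp: K_bcs_def)
  moreover have "- v \<in> E" using assms v by (auto simp: K_bcs_def)
  ultimately have "(1/2) *\<^sub>R v + (1/2) *\<^sub>R (- v) \<in> E"
    using assms by (intro convexD) (auto simp: K_bcs_def)
  then show ?thesis by simp
qed

lemma K_bcs_scaleR:
  assumes "E \<in> K_bcs"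
  shows "(*\<^sub>R) c ` E \<in> K_bcs"
proof -
  have "uminus ` (*\<^sub>R) c ` E = (*\<^sub>R) c ` uminus ` E"
    by (simp add: image_image)
  with assms show ?thesis
    by (auto simp: K_bcs_def bounded_scaling convex_scaling closed_scaling)
qed

text \<open>A supremum exceeds \<open>a\<close> exactly when some element does, so each superlevel
  set consists of the points whose value meets an open set.\<close>

lemma borel_measurable_set_norm:
  assumes "setvalued_measurable F" and F: "\<And>x. F x \<in> K_bcs"
  shows "(\<lambda>x. set_norm (F x)) \<in> borel_measurable lebesgue"
  unfolding borel_measurable_iff_greater
proof
  fix a :: real
  have "a < set_norm (F x) \<longleftrightarrow> F x \<inter> {v. a < norm v} \<noteq> {}" for x
  proof -
    have "a < set_norm (F x) \<longleftrightarrow> (\<exists>v\<in>F x. a < norm v)"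
      unfolding set_norm_def using F[of x]
      by (intro less_cSUP_iff) (auto simp: K_bcs_def bdd_above_norm)
    then show ?thesis by auto
  qed
  moreover have "open {v :: 'b. a < norm v}"
    by (intro open_Collect_less continuous_intros)
  ultimately show "{x \<in> space lebesgue. a < set_norm (F x)} \<in> sets lebesgue"
    using assms(1) by (simp add: setvalued_measurable_def)
qed

section \<open>The Aumann integral as an element of \<open>K_bcs\<close>\<close>

text \<open>Puts the integral into the form of \<open>closed_integrals_of_selections\<close>, whose
  measure space must be finite.\<close>

lemma aumann_integral_eq_restrict_space:
  assumes "Q \<in> sets lebesgue"
  shows "aumann_integral Q F = {\<integral>x. f x \<partial>restrict_space lebesgue Q | f.
    integrable (restrict_space lebesgue Q) f \<and> (AE x in restrict_space lebesgue Q. f x \<in> F x)}"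
  using assms unfolding aumann_integral_def set_integrable_def set_lebesgue_integral_def
  by (simp add: integral_restrict_space integrable_restrict_space AE_restrict_space_iff)

lemma norm_aumann_integral_le:
  assumes F: "\<And>x. F x \<in> K_bcs"
    and int: "set_integrable lebesgue Q (\<lambda>x. set_norm (F x))"
    and v: "v \<in> aumann_integral Q F"
  shows "norm v \<le> (LINT x:Q|lebesgue. set_norm (F x))"
proof -
  obtain f where f: "set_integrable lebesgue Q f" "AE y in lebesgue. y \<in> Q \<longrightarrow> f y \<in> F y"
    and v: "v = (LINT y:Q|lebesgue. f y)"
    using v by (auto simp: aumann_integral_def)
  have "AE y in lebesgue. norm (indicator Q y *\<^sub>R f y) \<le> indicator Q y *\<^sub>R set_norm (F y)"
    using f(2)
  proof eventually_elim
    case (elim y)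
    with F[of y] show ?case
      by (auto simp: indicator_def K_bcs_def intro!: norm_le_set_norm)
  qed
  then show ?thesis
    using int f(1) unfolding v set_lebesgue_integral_def set_integrable_def
    by (intro order_trans[OF integral_norm_bound integral_mono_AE] integrable_norm)
qed

text \<open>Apart from closedness and boundedness, each property is inherited pointwise: the zero
  function, convex combinations and negatives of selections are selections.\<close>

lemma aumann_integral_in_K_bcs:
  assumes Q: "Q \<in> lmeasurable"
    and F: "\<And>x. F x \<in> K_bcs"
    and int: "set_integrable lebesgue Q (\<lambda>x. set_norm (F x))"
  shows "aumann_integral Q F \<in> K_bcs"
proof -
  have Q_sets: "Q \<in> sets lebesgue" using Q by auto
  note A_eq = aumann_integral_eq_restrict_space[OF Q_sets, of F]
  define R where "R = restrict_space lebesgue Q"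
  have "finite_measure R"
    unfolding R_def using fmeasurableD2[OF Q] Q_sets
    by (intro finite_measureI) (auto simp: emeasure_restrict_space space_restrict_space)
  moreover have "integrable R (\<lambda>x. set_norm (F x))"
    using int Q_sets by (simp add: R_def set_integrable_def integrable_restrict_space)
  ultimately have "closed (aumann_integral Q F)"
    unfolding A_eq R_def[symmetric]
    by (rule closed_integrals_of_selections) (use F in \<open>auto simp: K_bcs_def intro: norm_le_set_norm\<close>)
  moreover have "0 \<in> aumann_integral Q F"
    unfolding A_eq using zero_mem_K_bcs[OF F] by (auto intro!: exI[of _ "\<lambda>_. 0"])
  moreover have "bounded (aumann_integral Q F)"
    using norm_aumann_integral_le[OF F int] by (auto intro!: boundedI)
  moreover have "convex (aumann_integral Q F)"
    unfolding A_eq R_def[symmetric]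
  proof (rule convexI, clarify)
    fix u t :: real and f h
    assume ut: "0 \<le> u" "0 \<le> t" "u + t = 1"
      and i: "integrable R f" "integrable R h"
      and "AE x in R. f x \<in> F x" "AE x in R. h x \<in> F x"
    from this(6,7) have "AE x in R. u *\<^sub>R f x + t *\<^sub>R h x \<in> F x"
      by eventually_elim (use F ut in \<open>auto simp: K_bcs_def intro!: convexD\<close>)
    with i show "\<exists>k. u *\<^sub>R integral\<^sup>L R f + t *\<^sub>R integral\<^sup>L R h = integral\<^sup>L R k \<and>
        integrable R k \<and> (AE x in R. k x \<in> F x)"
      by (intro exI[of _ "\<lambda>x. u *\<^sub>R f x + t *\<^sub>R h x"]) auto
  qed
  moreover have neg: "- v \<in> aumann_integral Q F" if v: "v \<in> aumann_integral Q F" for v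
  proof -
    obtain f where f: "integrable R f" "AE x in R. f x \<in> F x" "v = integral\<^sup>L R f"
      using v unfolding A_eq R_def[symmetric] by auto
    from f(2) have "AE x in R. - f x \<in> F x"
      by eventually_elim (use F in \<open>auto simp: K_bcs_def\<close>)
    with f(1,3) show ?thesis
      unfolding A_eq R_def[symmetric] by (auto intro!: exI[of _ "\<lambda>x. - f x"])
  qed
  have "uminus ` aumann_integral Q F = aumann_integral Q F"
    using neg by (force simp: image_iff)
  ultimately show ?thesis by (auto simp: K_bcs_def)
qed

section \<open>Estimates in Lp\<close>

text \<open>Used both to compare the integral over a set with the Lp norm and to bound a root of the
  measure of \<open>Q\<close> independently of the exponent.\<close>

lemma le_one_plus_powr:
  fixes x p :: real
  assumes "0 \<le> x" "1 \<le> p"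
  shows "x \<le> 1 + x powr p"
proof (cases "x \<le> 1")
  case True
  then show ?thesis by (simp add: add_increasing2)
next
  case False
  then have "x powr 1 \<le> x powr p" using assms by (intro powr_mono) auto
  with False show ?thesis by simp
qed

text \<open>Scaling \<open>t \<le> 1 + t\<^sup>p\<close> replaces Hoelder's inequality, at the price of a worse constant.\<close>

lemma set_integral_le_Lp:
  fixes g :: "'a \<Rightarrow> real"
  assumes [measurable]: "g \<in> borel_measurable M"
    and nonneg: "\<And>x. 0 \<le> g x"
    and p: "1 \<le> p"
    and int: "integrable M (\<lambda>x. g x powr p)"
    and Q: "Q \<in> fmeasurable M"
  shows "set_integrable M Q g"
    and "(LINT x:Q|M. g x) \<le> (measure M Q + 1) * (\<integral>x. g x powr p \<partial>M) powr (1 / p)"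
proof -
  have [measurable]: "Q \<in> sets M" using Q by auto
  have Q_int: "integrable M (indicator Q :: 'a \<Rightarrow> real)"
    using Q by (simp add: integrable_indicator_iff fmeasurable_def)
  have "integrable M (\<lambda>x. indicator Q x * g x)"
  proof (rule Bochner_Integration.integrable_bound)
    show "integrable M (\<lambda>x. indicator Q x + g x powr p)" using Q_int int by simp
    show "AE x in M. norm (indicator Q x * g x) \<le> norm (indicator Q x + g x powr p)"
      using le_one_plus_powr[OF nonneg p] nonneg by (auto simp: indicator_def)
  qed measurable
  then show gQ: "set_integrable M Q g" by (simp add: set_integrable_def)
  define I where "I = (\<integral>x. g x powr p \<partial>M)"
  define l where "l = I powr (1 / p)"
  have "0 \<le> I" unfolding I_def by (intro integral_nonneg_AE) auto
  \<comment> \<open>The scaling divides by the Lp norm \<open>l\<close>, so its vanishing is treated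
    apart; then \<open>g\<close> is zero almost everywhere.\<close>
  then consider "I = 0" | "0 < I" by linarith
  then have "(LINT x:Q|M. g x) \<le> (measure M Q + 1) * l"
  proof cases
    case 1
    then have "AE x in M. g x powr p = 0"
      using integral_nonneg_eq_0_iff_AE[OF int] by (simp add: I_def)
    then have "AE x in M. indicator Q x *\<^sub>R g x = 0" by eventually_elim simp
    then have "(LINT x:Q|M. g x) = 0"
      unfolding set_lebesgue_integral_def by (rule integral_eq_zero_AE)
    then show ?thesis by (simp add: l_def)
  next
    case 2
    then have l: "0 < l" "l powr p = I" using p by (auto simp: l_def powr_powr)
    have pt: "g x \<le> l * (1 + g x powr p / I)" for x
    proof -
      have "g x / l \<le> 1 + (g x / l) powr p" using nonneg l p by (intro le_one_plus_powr) auto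
      also have "(g x / l) powr p = g x powr p / I" using nonneg l by (simp add: powr_divide)
      finally show ?thesis using l by (simp add: pos_divide_le_eq mult.commute)
    qed
    have "(LINT x:Q|M. g x) \<le> (\<integral>x. l * (indicator Q x + g x powr p / I) \<partial>M)"
      unfolding set_lebesgue_integral_def
    proof (rule integral_mono)
      show "integrable M (\<lambda>x. indicator Q x *\<^sub>R g x)" using gQ by (simp add: set_integrable_def)
      show "integrable M (\<lambda>x. l * (indicator Q x + g x powr p / I))" using Q_int int by simp
      show "indicator Q x *\<^sub>R g x \<le> l * (indicator Q x + g x powr p / I)" for x
        using pt[of x] 2 l by (cases "x \<in> Q") auto
    qed
    \<comment> \<open>The normalised power g^p / I has integral 1, which is the source of the
      summand 1 in the constant.\<close>
    also have "\<dots> = l * (measure M Q + 1)"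
      using Q_int int 2 by (simp add: I_def[symmetric])
    finally show ?thesis by (simp add: mult.commute)
  qed
  then show "(LINT x:Q|M. g x) \<le> (measure M Q + 1) * (\<integral>x. g x powr p \<partial>M) powr (1 / p)"
    by (simp add: l_def I_def)
qed

lemma LK_D:
  assumes F: "F \<in> LK (ereal p)"
  shows "integrable lebesgue (\<lambda>x. set_norm (F x) powr p)"
    and "LK_norm (ereal p) F = ennreal ((\<integral>x. set_norm (F x) powr p \<partial>lebesgue) powr (1 / p))"
proof -
  have "setvalued_measurable F" "\<And>x. F x \<in> K_bcs" using F by (auto simp: LK_def)
  then have [measurable]: "(\<lambda>x. set_norm (F x)) \<in> borel_measurable lebesgue"
    by (rule borel_measurable_set_norm)
  \<comment> \<open>An infinite integral would make \<open>LK_norm\<close> infinite by its explicit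
    case distinction.\<close>
  have fin: "(\<integral>\<^sup>+ x. ennreal (set_norm (F x) powr p) \<partial>lebesgue) \<noteq> \<infinity>"
    using F by (auto simp: LK_def LK_norm_def Let_def split: if_splits)
  then show int: "integrable lebesgue (\<lambda>x. set_norm (F x) powr p)"
    by (intro integrableI_nonneg) (auto simp: less_top)
  show "LK_norm (ereal p) F = ennreal ((\<integral>x. set_norm (F x) powr p \<partial>lebesgue) powr (1 / p))"
    using fin unfolding LK_norm_def
    by (simp add: nn_integral_eq_integral[OF int] integral_nonneg_AE)
qed

section \<open>Functions constant on a set and on its complement\<close>

lemma setvalued_measurable_if:
  assumes "Q \<in> sets lebesgue"
  shows "setvalued_measurable (\<lambda>x. if x \<in> Q then E else E')"
  unfolding setvalued_measurable_def
proof (intro allI impI)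
  fix U
  have "{x. (if x \<in> Q then E else E') \<inter> U \<noteq> {}}
      = (if E \<inter> U \<noteq> {} then Q else {}) \<union> (if E' \<inter> U \<noteq> {} then UNIV - Q else {})"
    by auto
  with assms show "{x. (if x \<in> Q then E else E') \<inter> U \<noteq> {}} \<in> sets lebesgue"
    by (auto intro: sets.compl_sets[of _ lebesgue, simplified])
qed

text \<open>The norm equals |Q|^(1/q) times the norm of \<open>E\<close> for finite
  \<open>q\<close>, and is at most the norm of \<open>E\<close> for infinite \<open>q\<close>. The
  factor |Q| + 1 covers both cases.\<close>

lemma LK_norm_indicator_le:
  fixes E :: "'b::euclidean_space set" and Q :: "'a::euclidean_space set"
  assumes Q: "Q \<in> lmeasurable" and E: "E \<in> K_bcs" and q: "1 \<le> q"
  shows "LK_norm q (\<lambda>x. if x \<in> Q then E else {0}) \<le> ennreal ((measure lebesgue Q + 1) * set_norm E)"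
proof -
  define N where "N = set_norm E"
  have N: "0 \<le> N" using E by (auto simp: N_def K_bcs_def intro: set_norm_nonneg)
  have [measurable]: "Q \<in> sets lebesgue" using Q by auto
  have norm_eq: "set_norm (if x \<in> Q then E else {0}) = N * indicator Q x" for x
    by (simp add: N_def)
  show ?thesis
  proof (cases q)
    case (real r)
    with q have r: "1 \<le> r" by (simp add: one_ereal_def)
    define I where "I = (\<integral>\<^sup>+ x. ennreal ((N * indicator Q x) powr r) \<partial>(lebesgue :: 'a measure))"
    have "I = (\<integral>\<^sup>+ x. ennreal (N powr r) * indicator Q x \<partial>(lebesgue :: 'a measure))"
      unfolding I_def by (intro nn_integral_cong) (auto simp: indicator_def)
    also have "\<dots> = ennreal (N powr r) * emeasure lebesgue Q"
      by (subst nn_integral_cmult_indicator) auto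
    also have "\<dots> = ennreal (N powr r * measure lebesgue Q)"
      using Q by (simp add: emeasure_eq_measure2 ennreal_mult)
    finally have I: "I = ennreal (N powr r * measure lebesgue Q)" .
    \<comment> \<open>\<open>le_one_plus_powr\<close> at the r-th root of |Q|, whose r-th power is
      |Q| again.\<close>
    have "measure lebesgue Q powr (1 / r) \<le> 1 + (measure lebesgue Q powr (1 / r)) powr r"
      using r by (intro le_one_plus_powr) auto
    also have "\<dots> = measure lebesgue Q + 1" using r by (simp add: powr_powr)
    finally have "N * measure lebesgue Q powr (1 / r) \<le> (measure lebesgue Q + 1) * N"
      using N by (simp add: mult_left_mono mult.commute)
    moreover have "(N powr r * measure lebesgue Q) powr (1 / r) = N * measure lebesgue Q powr (1 / r)"
      using N r by (simp add: powr_mult powr_powr)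
    ultimately show ?thesis
      unfolding LK_norm_def norm_eq N_def[symmetric] real
      using I by (simp add: I_def ennreal_leI)
  next
    case PInf
    have "esssup lebesgue (\<lambda>x. ennreal (N * indicator Q x)) \<le> ennreal ((measure lebesgue Q + 1) * N)"
    proof (rule esssup_I)
      have "N * indicator Q x \<le> (measure lebesgue Q + 1) * N" for x
        using N by (auto simp: indicator_def algebra_simps)
      then show "AE x in lebesgue. ennreal (N * indicator Q x) \<le> ennreal ((measure lebesgue Q + 1) * N)"
        by (auto intro: ennreal_leI)
    qed measurable
    then show ?thesis unfolding LK_norm_def norm_eq N_def[symmetric] PInf by simp
  qed (use q in auto)
qed

section \<open>Measurability of cubes and the final estimate\<close>

text \<open>Whichever faces belong to the cube, it differs from its open box only by a part of the
  frontier, which is a null set.\<close>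

lemma axis_parallel_cube_lmeasurable:
  assumes "axis_parallel_cube Q"
  shows "Q \<in> lmeasurable"
proof -
  obtain a l I where I: "\<And>i. {a $ i <..< a $ i + l} \<subseteq> I i" "\<And>i. I i \<subseteq> {a $ i .. a $ i + l}"
    and Q: "Q = {x. \<forall>i. x $ i \<in> I i}"
    using assms unfolding axis_parallel_cube_def by blast
  define b where "b = (\<chi> i. a $ i + l)"
  have sub: "box a b \<subseteq> Q" "Q \<subseteq> cbox a b"
    using I by (fastforce simp: Q b_def mem_box_cart)+
  then have "negligible (Q - box a b)"
    by (intro negligible_subset[OF negligible_frontier_interval[of a b]]) auto
  then have "Q - box a b \<in> lmeasurable" by (rule negligible_imp_measurable)
  moreover have "Q = box a b \<union> (Q - box a b)" using sub by auto
  ultimately show ?thesis by (metis fmeasurable.Un lmeasurable_box)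
qed

theorem theorem3p2:
  fixes Q :: "(real ^ 'n) set" and \<alpha> :: real and p q :: ereal
  assumes "axis_parallel_cube Q"
    and "0 < \<alpha>" and "\<alpha> < 1"
    and "1 \<le> p" and "p < q" and "q \<le> \<infinity>"
    and "1 / p - 1 / q = ereal \<alpha>"
  shows "\<exists>C::real. 0 \<le> C \<and>
           (\<forall>F \<in> (LK p :: (real ^ 'n \<Rightarrow> (real ^ 'd) set) set).
              locally_integrably_bounded F \<and>
              frac_avg Q \<alpha> F \<in> LK q \<and>
              LK_norm q (frac_avg Q \<alpha> F) \<le> ennreal C * LK_norm p F)"
proof -
  have Q: "Q \<in> lmeasurable" using assms(1) by (rule axis_parallel_cube_lmeasurable)
  then have Q_sets: "Q \<in> sets lebesgue" by auto
  \<comment> \<open>Since \<open>p\<close> is strictly below \<open>q\<close>, it is finite; only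
    \<open>q\<close> can be infinite.\<close>
  obtain r where p: "p = ereal r" "1 \<le> r"
    using assms(4,5) by (cases p) (auto simp: one_ereal_def)
  have q: "1 \<le> q" using assms(4,5) by auto
  define c where "c = 1 / measure lebesgue Q powr (1 - \<alpha>)"
  define K where "K = measure lebesgue Q + 1"
  have c: "0 \<le> c" and K: "0 \<le> K" by (auto simp: c_def K_def)
  \<comment> \<open>In the constant, the inner \<open>K\<close> comes from bounding the integral
    over \<open>Q\<close> by the Lp norm, \<open>c\<close> from the normalisation of the average,
    and the outer \<open>K\<close> from the Lq norm of a function constant on
    \<open>Q\<close>.\<close>
  have "locally_integrably_bounded F \<and> frac_avg Q \<alpha> F \<in> LK q \<and>
      LK_norm q (frac_avg Q \<alpha> F) \<le> ennreal (K * (c * K)) * LK_norm p F"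
    if F: "F \<in> LK p" for F :: "real ^ 'n \<Rightarrow> (real ^ 'd) set"
  proof -
    have F_meas: "setvalued_measurable F" and F_K: "\<And>x. F x \<in> K_bcs"
      using F by (auto simp: LK_def)
    have g_meas: "(\<lambda>x. set_norm (F x)) \<in> borel_measurable lebesgue"
      using F_meas F_K by (rule borel_measurable_set_norm)
    have g_nonneg: "0 \<le> set_norm (F x)" for x
      using F_K[of x] by (auto simp: K_bcs_def intro: set_norm_nonneg)
    note LK = LK_D[OF F[unfolded p(1)]]
    note Lp = set_integral_le_Lp[OF g_meas g_nonneg p(2) LK(1)]
    \<comment> \<open>The norm of \<open>F\<close> itself serves as the bounding function; by
      \<open>Lp(1)\<close> it is integrable over every compact set.\<close>
    have "AE x in lebesgue. F x \<subseteq> cball 0 (set_norm (F x))"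
      using F_K by (auto simp: K_bcs_def intro!: AE_I2 norm_le_set_norm)
    then have bdd: "locally_integrably_bounded F"
      unfolding locally_integrably_bounded_def
      using F_meas g_meas g_nonneg Lp(1) lmeasurable_compact by blast
    have A: "aumann_integral Q F \<in> K_bcs"
      using Q F_K Lp(1)[OF Q] by (rule aumann_integral_in_K_bcs)
    define E where "E = (*\<^sub>R) c ` aumann_integral Q F"
    have E: "E \<in> K_bcs" unfolding E_def using A by (rule K_bcs_scaleR)
    \<comment> \<open>Off \<open>Q\<close> the scalar is 0, and a nonempty set scaled by 0 is
      \<open>{0}\<close>; membership of 0 supplies the nonemptiness.\<close>
    have avg: "frac_avg Q \<alpha> F = (\<lambda>x. if x \<in> Q then E else {0})"
      using zero_mem_K_bcs[OF A] by (auto simp: frac_avg_def E_def c_def fun_eq_iff)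
    have "set_norm E \<le> c * (K * (\<integral>x. set_norm (F x) powr r \<partial>lebesgue) powr (1 / r))"
    proof (rule set_norm_le)
      show "E \<noteq> {}" using E by (auto simp: K_bcs_def)
      fix v assume "v \<in> E"
      then obtain u where u: "u \<in> aumann_integral Q F" "v = c *\<^sub>R u" by (auto simp: E_def)
      have "norm u \<le> K * (\<integral>x. set_norm (F x) powr r \<partial>lebesgue) powr (1 / r)"
        using norm_aumann_integral_le[OF F_K Lp(1)[OF Q] u(1)] Lp(2)[OF Q] by (simp add: K_def)
      with u(2) c show "norm v \<le> c * (K * (\<integral>x. set_norm (F x) powr r \<partial>lebesgue) powr (1 / r))"
        by (simp add: mult_left_mono)
    qed
    then have "K * set_norm E \<le> (K * (c * K)) * (\<integral>x. set_norm (F x) powr r \<partial>lebesgue) powr (1 / r)"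
      using K by (simp add: mult_left_mono mult.assoc)
    then have "ennreal (K * set_norm E) \<le> ennreal (K * (c * K)) * LK_norm p F"
      using c K unfolding p(1) LK(2) by (simp add: ennreal_mult[symmetric] ennreal_leI)
    with LK_norm_indicator_le[OF Q E q]
    have le: "LK_norm q (frac_avg Q \<alpha> F) \<le> ennreal (K * (c * K)) * LK_norm p F"
      unfolding avg K_def by (rule order_trans)
    also have "\<dots> < \<infinity>" unfolding p(1) LK(2) by (simp add: ennreal_mult_less_top)
    finally have "LK_norm q (frac_avg Q \<alpha> F) < \<infinity>" .
    then have "frac_avg Q \<alpha> F \<in> LK q"
      using E setvalued_measurable_if[OF Q_sets, of E "{0}"]
      by (auto simp: LK_def avg K_bcs_def)
    with bdd le show ?thesis by blast
  qed
  moreover have "0 \<le> K * (c * K)" using c K by simp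
  ultimately show ?thesis by blast
qed

end
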